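(* For every real number $x\in(2,3)$, the triple $(x,x,x)\in\mathbb{C}^3$ lies in $\mathcal{B}\setminus\mathcal{SCH}$; that is, $(x,x,x)$ belongs to the Bowditch set $\mathcal{B}$ but not to Schottky space $\mathcal{SCH}$.
   Context: Let $F_2=\langle X,Y\rangle$ be the free group of rank 2. An element of $F_2$ is primitive if it is a member of a generating pair; let $\mathcal{P}$ be the set of primitive elements. For $(x,y,z)\in\mathbb{C}^3$ let $\rho_{(x,y,z)}:F_2\to SL(2,\mathbb{C})$ be a representation with $\operatorname{Tr}\rho(X)=x$, $\operatorname{Tr}\rho(Y)=y$, $\operatorname{Tr}\rho(XY)=z$; irreducible representations are determined up to conjugation by this trace triple, and the traces of all elements are determined by the triple in every case. The Bowditch set $\mathcal{B}$ is the set of $(x,y,z)\in\mathbb{C}^3$ corresponding to irreducible representations (equivalently, $\operatorname{Tr}\rho_{(x,y,z)}([X,Y])\neq 2$) such that $\operatorname{Tr}\rho_{(x,y,z)}(g)\notin[-2,2]$ for all $g\in\mathcal{P}$, and $\{g\in\mathcal{P}: |\operatorname{Tr}\rho_{(x,y,z)}(g)|\le 2\}$ is finite, where primitive elements are counted up to conjugacy and inversion. Schottky space $\mathcal{SCH}$ is the set of $(x,y,z)\in\mathbb{C}^3$ for which $\rho_{(x,y,z)}$ is faithful (so the image is free of rank 2) with discrete, purely loxodromic and geometrically finite image. *)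

theory Defs
  imports "HOL-Analysis.Analysis" "HOL-Algebra.Generated_Groups"
begin

section \<open>The free group of rank 2\<close>

text \<open>A letter is a generator together with an exponent sign: \<^term>\<open>True\<close> for the generator itself,
  \<^term>\<open>False\<close> for its inverse. The free group consists of the reduced words.\<close>

datatype gen = GX | GY

type_synonym word = "(gen \<times> bool) list"

definition inv_letter :: "gen \<times> bool \<Rightarrow> gen \<times> bool" where
  "inv_letter a = (fst a, \<not> snd a)"

definition reduced :: "word \<Rightarrow> bool" where
  "reduced w \<longleftrightarrow> successively (\<lambda>a b. b \<noteq> inv_letter a) w"

fun push :: "gen \<times> bool \<Rightarrow> word \<Rightarrow> word" where
  "push a [] = [a]"
| "push a (b # w) = (if b = inv_letter a then w else a # b # w)"

text \<open>For a reduced word \<open>v\<close>, \<^term>\<open>foldr push u v\<close> is the reduced form of the concatenation \<open>u @ v\<close>.\<close>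

definition F2 :: "word monoid" where
  "F2 = \<lparr>carrier = {w. reduced w}, monoid.mult = foldr push, one = []\<rparr>"

definition gX :: word where "gX = [(GX, True)]"
definition gY :: word where "gY = [(GY, True)]"

lemma inv_letter_inv_letter [simp]: "inv_letter (inv_letter a) = a"
  by (simp add: inv_letter_def)

lemma inv_letter_neq [simp]: "inv_letter a \<noteq> a" "a \<noteq> inv_letter a"
  by (metis inv_letter_def snd_conv)+

lemma inv_letter_eq_iff: "inv_letter a = b \<longleftrightarrow> a = inv_letter b"
  by auto

lemma reduced_Nil [simp]: "reduced []"
  by (simp add: reduced_def)

lemma reduced_ConsD: "reduced (a # w) \<Longrightarrow> reduced w"
  by (cases w) (auto simp: reduced_def)

lemma reduced_push: "reduced w \<Longrightarrow> reduced (push a w)"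
  by (cases w) (auto simp: reduced_def dest: reduced_ConsD[unfolded reduced_def])

lemma reduced_foldr_push: "reduced w \<Longrightarrow> reduced (foldr push u w)"
  by (induction u) (auto intro: reduced_push)

lemma push_eq_Cons: "reduced (a # w) \<Longrightarrow> push a w = a # w"
  by (cases w) (auto simp: reduced_def)

lemma push_inv_push: "reduced w \<Longrightarrow> push (inv_letter a) (push a w) = w"
  by (cases w) (auto intro: push_eq_Cons)

lemma foldr_push_push:
  "reduced w \<Longrightarrow> foldr push (push a u) w = push a (foldr push u w)"
proof (cases u)
  case (Cons b u')
  assume "reduced w"
  then show ?thesis
    using Cons push_inv_push[OF reduced_foldr_push, of w "inv_letter a" u'] by auto
qed simp

lemma foldr_push_assoc:
  "reduced w \<Longrightarrow> foldr push (foldr push u v) w = foldr push u (foldr push v w)"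
  by (induction u) (auto simp: foldr_push_push)

lemma foldr_push_Nil: "reduced w \<Longrightarrow> foldr push w [] = w"
proof (induction w)
  case (Cons a w)
  then show ?case
    using reduced_ConsD[OF Cons.prems] push_eq_Cons[OF Cons.prems] by simp
qed simp

lemma foldr_push_inverse: 
  "reduced v \<Longrightarrow> foldr push (rev (map inv_letter u)) (foldr push u v) = v"
  by (induction u) (auto simp: push_inv_push reduced_foldr_push)

lemma group_F2: "group F2"
proof (rule groupI)
  fix x assume x: "x \<in> carrier F2"
  let ?y = "foldr push (rev (map inv_letter x)) []"
  have "foldr push ?y x = foldr push (rev (map inv_letter x)) (foldr push [] x)"
    using x by (intro foldr_push_assoc) (simp add: F2_def)
  also have "\<dots> = foldr push (rev (map inv_letter x)) (foldr push x [])"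
    using x by (simp add: F2_def foldr_push_Nil)
  also have "\<dots> = []"
    by (rule foldr_push_inverse) simp
  finally show "\<exists>y\<in>carrier F2. y \<otimes>\<^bsub>F2\<^esub> x = \<one>\<^bsub>F2\<^esub>"
    by (intro bexI[of _ ?y]) (auto simp: F2_def reduced_foldr_push)
qed (auto simp: F2_def reduced_foldr_push foldr_push_assoc)

definition primitive :: "word \<Rightarrow> bool" where
  "primitive g \<longleftrightarrow> g \<in> carrier F2 \<and> (\<exists>h\<in>carrier F2. generate F2 {g, h} = carrier F2)"

text \<open>Two elements are identified if one is conjugate to the other or to its inverse.\<close>

definition conj_inv_rel :: "(word \<times> word) set" where
  "conj_inv_rel = {(g, h). g \<in> carrier F2 \<and> h \<in> carrier F2 \<and>
     (\<exists>u\<in>carrier F2. h = u \<otimes>\<^bsub>F2\<^esub> g \<otimes>\<^bsub>F2\<^esub> inv\<^bsub>F2\<^esub> u \<or>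
                     h = u \<otimes>\<^bsub>F2\<^esub> inv\<^bsub>F2\<^esub> g \<otimes>\<^bsub>F2\<^esub> inv\<^bsub>F2\<^esub> u)}"


section \<open>Representations into \<open>SL(2,\<complex>)\<close>\<close>

definition SL2C :: "(complex^2^2) monoid" where
  "SL2C = \<lparr>carrier = {A. det A = 1}, monoid.mult = (**), one = mat 1\<rparr>"

lemma group_SL2C: "group SL2C"
proof (rule groupI)
  fix A assume "A \<in> carrier SL2C"
  then have A: "det A = 1" by (simp add: SL2C_def)
  then obtain B where B: "B ** A = mat 1"
    using invertible_det_nz[of A] unfolding invertible_def by auto
  then have "det B = 1"
    using A by (metis det_I det_mul mult.right_neutral)
  then show "\<exists>B\<in>carrier SL2C. B \<otimes>\<^bsub>SL2C\<^esub> A = \<one>\<^bsub>SL2C\<^esub>"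
    using B by (auto simp: SL2C_def)
qed (auto simp: SL2C_def det_mul matrix_mul_assoc)

definition rep_with_traces ::
    "complex \<Rightarrow> complex \<Rightarrow> complex \<Rightarrow> (word \<Rightarrow> complex^2^2) \<Rightarrow> bool" where
  "rep_with_traces x y z \<rho> \<longleftrightarrow> \<rho> \<in> hom F2 SL2C \<and>
     trace (\<rho> gX) = x \<and> trace (\<rho> gY) = y \<and> trace (\<rho> (gX \<otimes>\<^bsub>F2\<^esub> gY)) = z"

definition irreducible_rep :: "(word \<Rightarrow> complex^2^2) \<Rightarrow> bool" where
  "irreducible_rep \<rho> \<longleftrightarrow>
     \<not> (\<exists>v. v \<noteq> 0 \<and> (\<forall>g\<in>carrier F2. \<exists>c. \<rho> g *v v = c *s v))"

text \<open>All the conditions below are invariant under conjugation of \<open>\<rho>\<close>, so for irreducible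
  (in particular, for faithful discrete) \<open>\<rho>\<close> they depend on the trace triple only.\<close>

definition Bowditch_set :: "(complex \<times> complex \<times> complex) set" where
  "Bowditch_set = {(x, y, z). \<exists>\<rho>. rep_with_traces x y z \<rho> \<and> irreducible_rep \<rho> \<and>
     (\<forall>g. primitive g \<longrightarrow> trace (\<rho> g) \<notin> complex_of_real ` {-2..2}) \<and>
     finite ({g. primitive g \<and> cmod (trace (\<rho> g)) \<le> 2} // conj_inv_rel)}"


section \<open>Hyperbolic 3-space and geometric finiteness\<close>

text \<open>The upper half-space model.\<close>

definition H3 :: "(complex \<times> real) set" where
  "H3 = {(w, t). t > 0}"

definition hyp_dist :: "complex \<times> real \<Rightarrow> complex \<times> real \<Rightarrow> real" where
  "hyp_dist p q =
     arcosh (1 + ((cmod (fst p - fst q))\<^sup>2 + (snd p - snd q)\<^sup>2) / (2 * snd p * snd q))"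

text \<open>The Poincare extension of the Moebius transformation \<open>w \<mapsto> (a w + b) / (c w + d)\<close>
  of a matrix of determinant 1.\<close>

definition H3_act :: "complex^2^2 \<Rightarrow> complex \<times> real \<Rightarrow> complex \<times> real" where
  "H3_act A p = (let a = A$1$1; b = A$1$2; c = A$2$1; d = A$2$2; w = fst p; t = snd p;
       N = (cmod (c * w + d))\<^sup>2 + (cmod c)\<^sup>2 * t\<^sup>2
     in (((a * w + b) * cnj (c * w + d) + a * cnj c * (complex_of_real t)\<^sup>2) / complex_of_real N,
         t / N))"

text \<open>The Dirichlet polyhedron centred at \<open>p\<close>, cut out by the elements of \<open>S\<close> only. Each
  \<open>g\<close> moving \<open>p\<close> contributes the half-space bounded by the bisector of \<open>p\<close> and \<open>g p\<close>.\<close>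

definition Dirichlet :: "(complex^2^2) set \<Rightarrow> complex \<times> real \<Rightarrow> (complex \<times> real) set" where
  "Dirichlet S p = {q \<in> H3. \<forall>g\<in>S. hyp_dist q p \<le> hyp_dist q (H3_act g p)}"

text \<open>A discrete group is geometrically finite if it has a finite-sided Dirichlet fundamental
  polyhedron, i.e. finitely many of the half-spaces already cut out the polyhedron. The centre
  must have trivial stabiliser in \<open>PSL(2,\<complex>)\<close> for the polyhedron to be a fundamental one.\<close>

definition geometrically_finite :: "(complex^2^2) set \<Rightarrow> bool" where
  "geometrically_finite G \<longleftrightarrow>
     (\<exists>p\<in>H3. (\<forall>g\<in>G. H3_act g p = p \<longrightarrow> g = mat 1 \<or> g = - mat 1) \<and>
        (\<exists>S. finite S \<and> S \<subseteq> G \<and> Dirichlet G p = Dirichlet S p))"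


section \<open>Schottky space\<close>

definition loxodromic :: "complex^2^2 \<Rightarrow> bool" where
  "loxodromic A \<longleftrightarrow> (\<exists>P\<in>carrier SL2C. \<exists>l. cmod l > 1 \<and>
     A = P ** vector [vector [l, 0], vector [0, inverse l]] ** matrix_inv P)"

definition purely_loxodromic :: "(complex^2^2) set \<Rightarrow> bool" where
  "purely_loxodromic G \<longleftrightarrow> (\<forall>A\<in>G. A \<noteq> mat 1 \<longrightarrow> loxodromic A)"

definition Schottky_space :: "(complex \<times> complex \<times> complex) set" where
  "Schottky_space = {(x, y, z). \<exists>\<rho>. rep_with_traces x y z \<rho> \<and>
     inj_on \<rho> (carrier F2) \<and>
     discrete (\<rho> ` carrier F2) \<and>
     purely_loxodromic (\<rho> ` carrier F2) \<and>
     geometrically_finite (\<rho> ` carrier F2)}"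

end

theory Submission
  imports Defs
begin

text \<open>
  Not in Schottky space: for every representation with traces \<open>(x, x, x)\<close> the commutator of the
  generators has trace \<open>3 x^2 - x^3 - 2\<close>, which lies strictly between \<open>-2\<close> and \<open>2\<close> when
  \<open>2 < x < 3\<close>; hence the commutator is mapped to an element that is neither trivial nor loxodromic.

  In the Bowditch set: there is a representation \<open>\<rho>\<close> by real matrices with these traces, and every
  primitive element has trace of modulus greater than 2 under it. For matrices of determinant 1,
  \<open>det (G H - H G) = 2 - tr [G, H]\<close>, and a real \<open>G\<close> for which this is positive for some real \<open>H\<close>
  is hyperbolic (\<open>trace_gt_2_if_det_bracket_pos\<close>). So it suffices that
  \<open>det (\<rho> g \<rho> h - \<rho> h \<rho> g) > 0\<close> for every generating pair \<open>g, h\<close>. This follows by deformation,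
  without Nielsen's theorem on generating pairs. Let \<open>x\<close> decrease to 2 along
  a family of representations \<open>\<rho>_t\<close> with \<open>x = (1 + t) + 1 / (1 + t)\<close> that ends at the trivial
  representation at \<open>t = 0\<close>. Each word has an expansion \<open>\<rho>_t w = 1 + t F t\<close> with \<open>F\<close> continuous and
  \<open>F 0\<close> determined by the exponent sums of \<open>w\<close> (\<open>word_first_order\<close>). Therefore
  \<open>det (\<rho>_t g \<rho>_t h - \<rho>_t h \<rho>_t g) = t^4 D t\<close> with \<open>D\<close> continuous and \<open>D 0 = 3 e^2\<close>, where \<open>e\<close> is the
  determinant of the exponent sums of \<open>g, h\<close>, which is nonzero for a generating pair
  (\<open>expsum_det_nonzero\<close>). For \<open>t > 0\<close> the representation \<open>\<rho>_t\<close> is irreducible, so \<open>D t\<close> does not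
  vanish (\<open>det_bracket_eq_0_of_generators\<close>). By the intermediate value theorem \<open>D\<close> is positive
  throughout (\<open>family_bracket_pos\<close>).
\<close>

section \<open>Two-by-two matrices\<close>

lemma mat2_eq_iff:
  fixes A B :: "'a^2^2"
  shows "A = B \<longleftrightarrow> A$1$1 = B$1$1 \<and> A$1$2 = B$1$2 \<and> A$2$1 = B$2$1 \<and> A$2$2 = B$2$2"
  by (auto simp: vec_eq_iff forall_2)

lemma mat2_mult_entry:
  fixes A B :: "'a::semiring_1^2^2"
  shows "(A ** B)$i$j = A$i$1 * B$1$j + A$i$2 * B$2$j"
  by (simp add: matrix_matrix_mult_def sum_2)

lemma mat2_vec_entry:
  fixes A :: "'a::semiring_1^2^2"
  shows "(A *v v)$i = A$i$1 * v$1 + A$i$2 * v$2"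
  by (simp add: matrix_vector_mult_def sum_2)

lemma vec2_eq_iff:
  fixes u v :: "'a^2"
  shows "u = v \<longleftrightarrow> u$1 = v$1 \<and> u$2 = v$2"
  by (auto simp: vec_eq_iff forall_2)

lemma trace_2: "trace (A :: 'a::comm_semiring_1^2^2) = A$1$1 + A$2$2"
  by (simp add: trace_def sum_2)

lemma mat_1_2_entries:
  "(mat 1 :: 'a::semiring_1^2^2)$1$1 = 1" "(mat 1 :: 'a::semiring_1^2^2)$1$2 = 0"
  "(mat 1 :: 'a::semiring_1^2^2)$2$1 = 0" "(mat 1 :: 'a::semiring_1^2^2)$2$2 = 1"
  by (simp_all add: mat_def)

lemmas mat2_simps = mat2_mult_entry mat2_vec_entry trace_2 det_2 mat_1_2_entries

text \<open>The adjugate, which is the inverse for determinant 1 and is polynomial in the entries.\<close>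

definition adj2 :: "'a::comm_ring_1^2^2 \<Rightarrow> 'a^2^2" where
  "adj2 A = vector [vector [A$2$2, - (A$1$2)], vector [- (A$2$1), A$1$1]]"

lemma adj2_entries [simp]:
  "adj2 A $1$1 = A$2$2" "adj2 A $1$2 = - (A$1$2)"
  "adj2 A $2$1 = - (A$2$1)" "adj2 A $2$2 = A$1$1"
  by (simp_all add: adj2_def)

lemma adj2_adj2 [simp]: "adj2 (adj2 A) = A"
  by (simp add: mat2_eq_iff)

lemma adj2_inverse:
  assumes "det A = 1"
  shows "adj2 A ** A = mat 1" "A ** adj2 A = mat 1"
  using assms by (auto simp: mat2_eq_iff mat2_simps algebra_simps)

lemma det_adj2 [simp]: "det (adj2 A) = det (A :: 'a::comm_ring_1^2^2)"
  by (simp add: det_2 algebra_simps)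

lemma left_inverse_eq_adj2:
  fixes A :: "'a::comm_ring_1^2^2"
  assumes "det A = 1" "B ** A = mat 1"
  shows "B = adj2 A"
proof -
  have "B = B ** (A ** adj2 A)"
    by (simp add: adj2_inverse(2)[OF assms(1)])
  also have "\<dots> = adj2 A"
    by (simp add: matrix_mul_assoc assms(2))
  finally show ?thesis .
qed

text \<open>Fricke's trace identity for the commutator.\<close>

lemma trace_commutator:
  fixes A B :: "'a::comm_ring_1^2^2"
  assumes "det A = 1" "det B = 1"
  shows "trace (A ** B ** adj2 A ** adj2 B) =
           (trace A)^2 + (trace B)^2 + (trace (A ** B))^2 - trace A * trace B * trace (A ** B) - 2"
proof -
  have "trace (A ** B ** adj2 A ** adj2 B) = (trace A)^2 * det B + (trace B)^2 * det A
          + (trace (A ** B))^2 - trace A * trace B * trace (A ** B) - 2 * (det A * det B)"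
    unfolding mat2_simps adj2_entries by (simp add: algebra_simps power2_eq_square)
  then show ?thesis by (simp add: assms)
qed

text \<open>A real matrix of determinant 1 is hyperbolic as soon as its Lie bracket with some other real
  matrix has positive determinant: in the quadratic space of traceless matrices with the form \<open>-det\<close>, of signature
  \<open>(2,1)\<close>, the traceless part of the matrix is orthogonal to the bracket, which is timelike, so it is
  spacelike or zero; and if it is zero, then so is the bracket.\<close>

lemma trace_gt_2_if_det_bracket_pos:
  fixes G H :: "real^2^2"
  assumes "det G = 1" and pos: "det (G ** H - H ** G) > 0"
  shows "\<bar>trace G\<bar> > 2"
proof (rule ccontr)
  define N where "N = G ** H - H ** G"
  define b c d n p q where "b = G$1$2" and "c = G$2$1" and "d = G$1$1 - G$2$2"
    and "n = N$1$1" and "p = N$1$2" and "q = N$2$1"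
  note defs = b_def c_def d_def n_def p_def q_def N_def
  \<comment> \<open>\<open>d^2 + 4 b c\<close> is the discriminant of \<open>G\<close>, and \<open>-(n^2 + p q)\<close> is the determinant of \<open>N\<close>.\<close>
  assume "\<not> \<bar>trace G\<bar> > 2"
  then have "(trace G)^2 \<le> 2^2"
    by (intro abs_le_square_iff[THEN iffD1]) simp
  moreover have "(trace G)^2 - 4 = d^2 + 4 * (b * c)"
    using assms(1) unfolding mat2_simps defs by algebra
  ultimately have disc: "4 * (- (b * c)) \<ge> d^2"
    by simp
  have orth: "b * q + c * p = - (d * n)"
    unfolding defs by (simp add: mat2_simps algebra_simps)
  have npos: "- (p * q) > n^2"
    using pos unfolding defs by (simp add: mat2_simps algebra_simps power2_eq_square)
  have "4 * (- (b * c)) * (- (p * q)) \<le> (b * q + c * p)^2"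
    using zero_le_power2[of "b * q - c * p"] by (simp add: power2_eq_square algebra_simps)
  also have "\<dots> = d^2 * n^2"
    unfolding orth by (simp add: power_mult_distrib)
  finally have le: "4 * (- (b * c)) * (- (p * q)) \<le> d^2 * n^2" .
  have pq: "- (p * q) > 0"
    using npos zero_le_power2[of n] by linarith
  have "d^2 * (- (p * q)) \<le> 4 * (- (b * c)) * (- (p * q))"
    using disc pq by (intro mult_right_mono) auto
  then have le2: "d^2 * (- (p * q)) \<le> d^2 * n^2"
    using le by linarith
  have "d = 0"
  proof (rule ccontr)
    assume "d \<noteq> 0"
    then have "d^2 * n^2 < d^2 * (- (p * q))"
      using npos by (intro mult_strict_left_mono) auto
    with le2 show False by linarith
  qed
  then have "4 * (- (b * c)) * (- (p * q)) \<le> 0" "- (b * c) \<ge> 0"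
    using le disc by auto
  then have bc: "b * c = 0"
    using pq mult_pos_pos[of "- (b * c)" "- (p * q)"] by linarith
  have bqcp: "b * q + c * p = 0"
    using orth \<open>d = 0\<close> by simp
  have "p \<noteq> 0" "q \<noteq> 0" using pq by auto
  then have "b = 0 \<and> c = 0"
    using bc bqcp by auto
  then have "det N = 0"
    using \<open>d = 0\<close> unfolding defs by (simp add: mat2_simps algebra_simps)
  then show False
    using pos by (simp add: N_def)
qed

text \<open>The bracket \<open>N\<close> satisfies \<open>N G + G N = (tr G) N\<close>, and likewise for \<open>H\<close>; so the kernel
  of \<open>N\<close> is invariant under both matrices. It is a line when \<open>N\<close> is singular and nonzero. No
  field extension is needed for the eigenvector, in contrast to the case \<open>N = 0\<close>.\<close>

lemma common_eigenvector_of_singular_bracket: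
  fixes G H :: "'a::field^2^2"
  defines "N \<equiv> G ** H - H ** G"
  assumes "det N = 0" "N \<noteq> 0"
  obtains v c d where "v \<noteq> 0" "G *v v = c *s v" "H *v v = d *s v"
proof -
  have tr0: "N$2$2 = - (N$1$1)"
    by (simp add: N_def mat2_simps algebra_simps)
  have det0: "N$1$1 * N$1$1 + N$1$2 * N$2$1 = 0"
    using assms(2) tr0 by (simp add: det_2) algebra
  have nz: "N$1$1 \<noteq> 0 \<or> N$1$2 \<noteq> 0 \<or> N$2$1 \<noteq> 0"
    using assms(3) tr0 by (auto simp: mat2_eq_iff)
  define v :: "'a^2" where
    "v = (if N$1$1 = 0 \<and> N$1$2 = 0 then vector [0, 1] else vector [N$1$2, - (N$1$1)])"
  have v0: "v \<noteq> 0"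
    by (auto simp: v_def vec2_eq_iff)
  have Nv: "N *v v = 0"
    using tr0 det0 by (auto simp: v_def vec2_eq_iff mat2_simps algebra_simps add_eq_0_iff2)
  have ker: "\<exists>c. u = c *s v" if u: "N *v u = 0" for u
  proof -
    have *: "N$1$1 * u$1 + N$1$2 * u$2 = 0" "N$2$1 * u$1 - N$1$1 * u$2 = 0"
      "N$1$1 * v$1 + N$1$2 * v$2 = 0" "N$2$1 * v$1 - N$1$1 * v$2 = 0"
      using u Nv tr0 by (auto simp: vec2_eq_iff mat2_simps)
    have "N$1$1 * (u$1 * v$2 - u$2 * v$1) = 0" "N$1$2 * (u$1 * v$2 - u$2 * v$1) = 0"
      "N$2$1 * (u$1 * v$2 - u$2 * v$1) = 0"
      using * by algebra+
    then have uv: "u$1 * v$2 = u$2 * v$1"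
      using nz by auto
    show ?thesis
    proof (cases "v$1 = 0")
      case True
      then have "v$2 \<noteq> 0" using v0 by (auto simp: vec2_eq_iff)
      then show ?thesis using True uv
        by (intro exI[of _ "u$2 / v$2"]) (auto simp: vec2_eq_iff)
    next
      case False
      then show ?thesis using uv
        by (intro exI[of _ "u$1 / v$1"]) (auto simp: vec2_eq_iff field_simps)
    qed
  qed
  have "N *v (G *v v) = trace G *s (N *v v) - G *v (N *v v)"
    unfolding N_def by (simp add: vec2_eq_iff mat2_simps algebra_simps)
  moreover have "N *v (H *v v) = trace H *s (N *v v) - H *v (N *v v)"
    unfolding N_def by (simp add: vec2_eq_iff mat2_simps algebra_simps)
  ultimately have "N *v (G *v v) = 0" "N *v (H *v v) = 0"
    unfolding Nv by simp_all
  then show thesis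
    using ker v0 that by metis
qed

lemma det_bracket_eq_0_if_common_eigenvector:
  fixes G H :: "'a::field^2^2"
  assumes "v \<noteq> 0" "G *v v = c *s v" "H *v v = d *s v"
  shows "det (G ** H - H ** G) = 0"
proof (rule ccontr)
  let ?N = "G ** H - H ** G"
  assume "det ?N \<noteq> 0"
  then obtain M where M: "M ** ?N = mat 1"
    using invertible_det_nz[of ?N] unfolding invertible_def by auto
  have "?N *v v = G *v (H *v v) - H *v (G *v v)"
    by (simp add: matrix_vector_mult_diff_rdistrib matrix_vector_mul_assoc)
  also have "\<dots> = 0"
    by (simp add: assms(2,3) vector_scalar_commute mult.commute)
  finally have "?N *v v = 0" .
  then have "(M ** ?N) *v v = 0"
    by (simp flip: matrix_vector_mul_assoc)
  with M assms(1) show False by simp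
qed

section \<open>Generating pairs and reducibility\<close>

text \<open>If the bracket of the images of a generating pair is singular, then so is that of any two
  images: the images of the pair either commute or share an eigenvector, and this property passes
  to everything that they generate.\<close>

lemma det_bracket_eq_0_of_generators:
  fixes \<rho> :: "word \<Rightarrow> 'a::field^2^2"
  assumes hom: "\<And>u v. u \<in> carrier F2 \<Longrightarrow> v \<in> carrier F2 \<Longrightarrow> \<rho> (u \<otimes>\<^bsub>F2\<^esub> v) = \<rho> u ** \<rho> v"
    and one: "\<rho> \<one>\<^bsub>F2\<^esub> = mat 1"
    and det1: "\<And>u. u \<in> carrier F2 \<Longrightarrow> det (\<rho> u) = 1"
    and gh: "g \<in> carrier F2" "h \<in> carrier F2" "generate F2 {g, h} = carrier F2"
    and bracket: "det (\<rho> g ** \<rho> h - \<rho> h ** \<rho> g) = 0"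
    and uv: "u \<in> carrier F2" "v \<in> carrier F2"
  shows "det (\<rho> u ** \<rho> v - \<rho> v ** \<rho> u) = 0"
proof -
  interpret F2: group F2 by (rule group_F2)
  have inv: "\<rho> (inv\<^bsub>F2\<^esub> w) = adj2 (\<rho> w)" if w: "w \<in> carrier F2" for w
  proof (rule left_inverse_eq_adj2[OF det1[OF w]])
    show "\<rho> (inv\<^bsub>F2\<^esub> w) ** \<rho> w = mat 1"
      using hom[of "inv\<^bsub>F2\<^esub> w" w] w one by simp
  qed
  have induct: "P (\<rho> w)" if w: "w \<in> carrier F2" and "P (mat 1)" "P (\<rho> g)" "P (\<rho> h)"
    "\<And>M. P M \<Longrightarrow> det M = 1 \<Longrightarrow> P (adj2 M)" "\<And>L M. P L \<Longrightarrow> P M \<Longrightarrow> P (L ** M)" for w and P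
  proof -
    have "w \<in> generate F2 {g, h}" using w gh by simp
    then show ?thesis
    proof (induction rule: generate.induct)
      case (eng u v)
      then have "u \<in> carrier F2" "v \<in> carrier F2" using gh by auto
      then show ?case using eng that hom by simp
    qed (use that one inv det1 gh in auto)
  qed
  show ?thesis
  proof (cases "\<rho> g ** \<rho> h - \<rho> h ** \<rho> g = 0")
    case True
    have adj: "M ** adj2 L = adj2 L ** M" if "M ** L = L ** M" for L M :: "'a^2^2"
    proof -
      have "M ** adj2 L - adj2 L ** M = L ** M - M ** L"
        by (simp add: mat2_eq_iff mat2_simps algebra_simps)
      then show ?thesis using that by simp
    qed
    have mul: "M ** (K ** L) = (K ** L) ** M" if "M ** K = K ** M" "M ** L = L ** M"
      for K L M :: "'a^2^2"
      by (metis matrix_mul_assoc that)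
    have comm_gen: "M ** \<rho> w = \<rho> w ** M"
      if "w \<in> carrier F2" "M ** \<rho> g = \<rho> g ** M" "M ** \<rho> h = \<rho> h ** M" for M w
    proof (rule induct[OF that(1), where P = "\<lambda>L. M ** L = L ** M"])
      show "M ** mat 1 = mat 1 ** M" by simp
    qed (fact that | rule adj mul, assumption+)+
    have gh_comm: "\<rho> g ** \<rho> h = \<rho> h ** \<rho> g"
      using True by simp
    have swap: "\<rho> w ** \<rho> g = \<rho> g ** \<rho> w" "\<rho> w ** \<rho> h = \<rho> h ** \<rho> w" if "w \<in> carrier F2" for w
      using comm_gen[OF that refl gh_comm] comm_gen[OF that gh_comm[symmetric] refl] by metis+
    have "\<rho> u ** \<rho> v = \<rho> v ** \<rho> u"
      by (rule comm_gen[OF uv(2) swap[OF uv(1)]])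
    then show ?thesis by (simp add: det_2)
  next
    case False
    then obtain e c d where e: "e \<noteq> 0" "\<rho> g *v e = c *s e" "\<rho> h *v e = d *s e"
      using common_eigenvector_of_singular_bracket[OF bracket] by blast
    have "\<exists>c. \<rho> w *v e = c *s e" if "w \<in> carrier F2" for w
      using that
    proof (rule induct[of _ "\<lambda>M. \<exists>c. M *v e = c *s e"])
      fix M :: "'a^2^2" assume M: "\<exists>c. M *v e = c *s e" "det M = 1"
      then obtain c where c: "M *v e = c *s e" by auto
      have "adj2 M *v e = (trace M - c) *s e"
        using c by (auto simp: vec2_eq_iff mat2_simps algebra_simps)
      then show "\<exists>c. adj2 M *v e = c *s e" by blast
    next
      fix L M :: "'a^2^2" assume "\<exists>c. L *v e = c *s e" "\<exists>c. M *v e = c *s e"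
      then obtain a b where "L *v e = a *s e" "M *v e = b *s e" by auto
      then have "(L ** M) *v e = (b * a) *s e"
        by (simp only: matrix_vector_mul_assoc[symmetric] vector_scalar_commute vector_smult_assoc)
      then show "\<exists>c. (L ** M) *v e = c *s e" by blast
    qed (use e in \<open>auto intro: exI[of _ 1]\<close>)
    then show ?thesis
      using det_bracket_eq_0_if_common_eigenvector[OF e(1)] uv by metis
  qed
qed


section \<open>Evaluation of words in matrices\<close>

text \<open>The representation that sends the generators of \<open>F2\<close> to two given matrices of
  determinant 1, with adjugates in the place of inverses; \<open>eval_letter\<close> is its value on letters.\<close>

definition eval_letter :: "'a::comm_ring_1^2^2 \<Rightarrow> 'a^2^2 \<Rightarrow> gen \<times> bool \<Rightarrow> 'a^2^2" where
  "eval_letter A B l = (let M = (case fst l of GX \<Rightarrow> A | GY \<Rightarrow> B) in if snd l then M else adj2 M)"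

definition eval_word :: "'a::comm_ring_1^2^2 \<Rightarrow> 'a^2^2 \<Rightarrow> word \<Rightarrow> 'a^2^2" where
  "eval_word A B w = foldr (\<lambda>l M. eval_letter A B l ** M) w (mat 1)"

lemma eval_word_Nil [simp]: "eval_word A B [] = mat 1"
  and eval_word_Cons [simp]: "eval_word A B (l # w) = eval_letter A B l ** eval_word A B w"
  by (simp_all add: eval_word_def)

lemma eval_letter_inv: "eval_letter A B (inv_letter l) = adj2 (eval_letter A B l)"
  by (simp add: eval_letter_def inv_letter_def Let_def)

context
  fixes A B :: "'a::comm_ring_1^2^2"
  assumes dets: "det A = 1" "det B = 1"
begin

lemma det_eval_letter: "det (eval_letter A B l) = 1"
  using dets by (simp add: eval_letter_def Let_def split: gen.split)

lemma det_eval_word: "det (eval_word A B w) = 1"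
  by (induction w) (simp_all add: det_mul det_eval_letter)

lemma eval_word_push: "eval_word A B (push l w) = eval_letter A B l ** eval_word A B w"
proof (cases w)
  case (Cons b w')
  have "eval_letter A B l ** (eval_letter A B (inv_letter l) ** M) = M" for M :: "'a^2^2"
    by (simp add: matrix_mul_assoc eval_letter_inv adj2_inverse(2) det_eval_letter)
  then show ?thesis by (simp add: Cons)
qed simp

lemma eval_word_mult: "eval_word A B (u \<otimes>\<^bsub>F2\<^esub> v) = eval_word A B u ** eval_word A B v"
proof -
  have "eval_word A B (foldr push u v) = eval_word A B u ** eval_word A B v"
    by (induction u) (simp_all add: eval_word_push matrix_mul_assoc)
  then show ?thesis by (simp add: F2_def)
qed

end

lemma gX_in_F2: "gX \<in> carrier F2" and gY_in_F2: "gY \<in> carrier F2"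
  by (simp_all add: F2_def gX_def gY_def reduced_def)

lemma eval_word_gX: "eval_word A B gX = A" and eval_word_gY: "eval_word A B gY = B"
  by (simp_all add: gX_def gY_def eval_letter_def)

section \<open>Exponent sums\<close>

text \<open>The exponent sum of a generator in a word, with real values. The two exponent sums give the
  abelianization of \<open>F2\<close>.\<close>

definition expsum :: "gen \<Rightarrow> word \<Rightarrow> real" where
  "expsum k w = (\<Sum>l\<leftarrow>w. if fst l = k then (if snd l then 1 else -1) else 0)"

lemma expsum_Nil [simp]: "expsum k [] = 0"
  by (simp add: expsum_def)

lemma expsum_Cons:
  "expsum k (l # w) = (if fst l = k then (if snd l then 1 else -1) else 0) + expsum k w"
  by (simp add: expsum_def)

lemma expsum_push: "expsum k (push l w) = expsum k (l # w)"
  by (cases w) (auto simp: expsum_Cons inv_letter_def)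

lemma expsum_mult: "expsum k (u \<otimes>\<^bsub>F2\<^esub> v) = expsum k u + expsum k v"
proof -
  have "expsum k (foldr push u v) = expsum k u + expsum k v"
    by (induction u) (simp_all add: expsum_push expsum_Cons)
  then show ?thesis by (simp add: F2_def)
qed

text \<open>A linear combination of the two exponent sums that vanishes on a generating pair vanishes
  on the two free generators, and so is trivial.\<close>

lemma expsum_det_nonzero:
  assumes gh: "g \<in> carrier F2" "h \<in> carrier F2" "generate F2 {g, h} = carrier F2"
  shows "expsum GX g * expsum GY h - expsum GY g * expsum GX h \<noteq> 0"
proof
  interpret F2: group F2 by (rule group_F2)
  assume det0: "expsum GX g * expsum GY h - expsum GY g * expsum GX h = 0"
  have zero: "p = 0 \<and> q = 0" if pq: "p * expsum GX g + q * expsum GY g = 0"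
    "p * expsum GX h + q * expsum GY h = 0" for p q
  proof -
    define \<phi> where "\<phi> w = p * expsum GX w + q * expsum GY w" for w
    have mult: "\<phi> (u \<otimes>\<^bsub>F2\<^esub> v) = \<phi> u + \<phi> v" for u v
      by (simp add: \<phi>_def expsum_mult algebra_simps)
    have one: "\<phi> \<one>\<^bsub>F2\<^esub> = 0"
      by (simp add: \<phi>_def F2_def)
    have "\<phi> w = 0" if "w \<in> generate F2 {g, h}" for w
      using that
    proof (induction rule: generate.induct)
      case (inv w)
      then have "\<phi> (inv\<^bsub>F2\<^esub> w \<otimes>\<^bsub>F2\<^esub> w) = 0" "\<phi> w = 0"
        using gh one pq by (auto simp: \<phi>_def)
      then show ?case by (simp add: mult)
    qed (use one pq in \<open>auto simp: mult\<close>, auto simp: \<phi>_def)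
    then have "\<phi> gX = 0" "\<phi> gY = 0"
      using gh(3) gX_in_F2 gY_in_F2 by auto
    then show ?thesis
      by (simp add: \<phi>_def gX_def gY_def expsum_Cons)
  qed
  have "expsum GY g = 0 \<and> - expsum GX g = 0" "expsum GY h = 0 \<and> - expsum GX h = 0"
    using det0 by (intro zero; simp add: algebra_simps)+
  then show False
    using zero[of 1 0] by auto
qed

section \<open>A family of representations degenerating to the trivial one\<close>

lemma continuous_on_mat2I:
  fixes F :: "real \<Rightarrow> real^2^2"
  assumes "continuous_on S (\<lambda>t. F t $1$1)" "continuous_on S (\<lambda>t. F t $1$2)"
    "continuous_on S (\<lambda>t. F t $2$1)" "continuous_on S (\<lambda>t. F t $2$2)"
  shows "continuous_on S F"
proof -
  have "continuous_on S (\<lambda>t. F t $ i $ j)" for i j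
    using exhaust_2[of i] exhaust_2[of j] assms by metis
  then have "continuous_on S (\<lambda>t. \<chi> i j. F t $ i $ j)"
    by (intro continuous_on_vec_lambda)
  then show ?thesis by simp
qed

text \<open>For \<open>t \<ge> 0\<close> the matrices \<open>famA t = 1 + t famU t\<close> and \<open>famB t = 1 + t famV t\<close> have
  determinant 1, and they and their product have trace \<open>(1 + t) + 1 / (1 + t)\<close>. Here \<open>famA t\<close> is
  diagonal with eigenvalues \<open>1 + t\<close> and \<open>1 / (1 + t)\<close>; the traces and the determinant then fix
  \<open>famB t\<close> up to conjugation by diagonal matrices. The upper right entry is chosen as \<open>t\<close>, which
  makes both matrices rational in \<open>t\<close> and equal to the identity at \<open>t = 0\<close>.\<close>

definition famU :: "real \<Rightarrow> real^2^2" where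
  "famU t = vector [vector [1, 0], vector [0, - 1 / (1 + t)]]"

definition famV :: "real \<Rightarrow> real^2^2" where
  "famV t = vector [vector [- 1 / ((1 + t) * (2 + t)), 1],
      vector [((1 + t)\<^sup>2 + (1 + t) + 1) / ((1 + t) * (2 + t)\<^sup>2), (1 + t) / (2 + t)]]"

definition famA :: "real \<Rightarrow> real^2^2" where "famA t = mat 1 + t *\<^sub>R famU t"
definition famB :: "real \<Rightarrow> real^2^2" where "famB t = mat 1 + t *\<^sub>R famV t"

lemma famU_entries [simp]:
  "famU t $1$1 = 1" "famU t $1$2 = 0" "famU t $2$1 = 0" "famU t $2$2 = - 1 / (1 + t)"
  by (simp_all add: famU_def)

lemma famV_entries [simp]:
  "famV t $1$1 = - 1 / ((1 + t) * (2 + t))" "famV t $1$2 = 1"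
  "famV t $2$1 = ((1 + t)\<^sup>2 + (1 + t) + 1) / ((1 + t) * (2 + t)\<^sup>2)"
  "famV t $2$2 = (1 + t) / (2 + t)"
  by (simp_all add: famV_def)

lemma famA_entries:
  assumes "t \<ge> 0"
  shows "famA t $1$1 = 1 + t" "famA t $1$2 = 0" "famA t $2$1 = 0" "famA t $2$2 = 1 / (1 + t)"
  using assms by (simp_all add: famA_def mat_1_2_entries field_simps)

lemma famB_entries:
  assumes "t \<ge> 0"
  shows "famB t $1$1 = ((1 + t)\<^sup>2 + 1) / ((1 + t) * (2 + t))" "famB t $1$2 = t"
    "famB t $2$1 = t * (((1 + t)\<^sup>2 + (1 + t) + 1) / ((1 + t) * (2 + t)\<^sup>2))"
    "famB t $2$2 = ((1 + t)\<^sup>2 + 1) / (2 + t)"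
proof -
  have nz: "1 + t \<noteq> 0" "2 + t \<noteq> 0" using assms by auto
  show "famB t $1$1 = ((1 + t)\<^sup>2 + 1) / ((1 + t) * (2 + t))"
    using nz unfolding famB_def vector_add_component vector_scaleR_component famV_entries mat_1_2_entries
    by (simp add: divide_simps) (simp add: algebra_simps power2_eq_square)
  show "famB t $2$2 = ((1 + t)\<^sup>2 + 1) / (2 + t)"
    using nz unfolding famB_def vector_add_component vector_scaleR_component famV_entries mat_1_2_entries
    by (simp add: divide_simps) (simp add: algebra_simps power2_eq_square)
qed (simp_all add: famB_def mat_1_2_entries)

lemma famA_props:
  assumes "t \<ge> 0"
  shows "det (famA t) = 1" "trace (famA t) = 1 + t + 1 / (1 + t)"
  using assms by (simp_all add: mat2_simps famA_entries)

lemma famB_props: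
  assumes "t \<ge> 0"
  shows "det (famB t) = 1" "trace (famB t) = 1 + t + 1 / (1 + t)"
    "trace (famA t ** famB t) = 1 + t + 1 / (1 + t)"
proof -
  \<comment> \<open>With \<open>m = 1 + t\<close> all entries are rational functions of the eigenvalue \<open>m\<close> of \<open>famA t\<close>.\<close>
  define m where "m = 1 + t"
  have m: "m \<noteq> 0" "m + 1 \<noteq> 0" "2 + t = m + 1" "t = m - 1" using assms by (auto simp: m_def)
  have "(m\<^sup>2 + 1) / (m * (m + 1)) * ((m\<^sup>2 + 1) / (m + 1)) -
          (m - 1) * ((m - 1) * ((m\<^sup>2 + m + 1) / (m * (m + 1)\<^sup>2))) = 1"
  proof -
    have "(m\<^sup>2 + 1) / (m * (m + 1)) * ((m\<^sup>2 + 1) / (m + 1)) -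
          (m - 1) * ((m - 1) * ((m\<^sup>2 + m + 1) / (m * (m + 1)\<^sup>2)))
        = ((m\<^sup>2 + 1)\<^sup>2 - (m - 1)\<^sup>2 * (m\<^sup>2 + m + 1)) / (m * (m + 1)\<^sup>2)"
      by (simp add: power2_eq_square diff_divide_distrib mult.assoc)
    also have "(m\<^sup>2 + 1)\<^sup>2 - (m - 1)\<^sup>2 * (m\<^sup>2 + m + 1) = m * (m + 1)\<^sup>2"
      by algebra
    finally show ?thesis using m by simp
  qed
  then show "det (famB t) = 1"
    using assms by (simp only: det_2 famB_entries m(3) m_def[symmetric]) (simp add: m(4))
  have tr: "(m\<^sup>2 + 1) / (m * (m + 1)) + (m\<^sup>2 + 1) / (m + 1) = m + 1 / m"
    "m * ((m\<^sup>2 + 1) / (m * (m + 1))) + 1 / m * ((m\<^sup>2 + 1) / (m + 1)) = m + 1 / m"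
    using m(1,2) by (simp_all add: divide_simps) algebra+
  show "trace (famB t) = 1 + t + 1 / (1 + t)"
    "trace (famA t ** famB t) = 1 + t + 1 / (1 + t)"
    using assms tr
    by (simp_all add: trace_2 mat2_mult_entry famA_entries famB_entries m(3) m_def[symmetric])
qed

lemma famU_famV_continuous:
  "continuous_on {0..} famU" "continuous_on {0..} famV"
proof -
  have nz: "1 + t \<noteq> 0" "2 + t \<noteq> 0" if "t \<ge> 0" for t :: real using that by auto
  show "continuous_on {0..} famU"
    by (rule continuous_on_mat2I; unfold famU_entries; intro continuous_intros; simp add: nz)
  show "continuous_on {0..} famV"
    by (rule continuous_on_mat2I; unfold famV_entries; intro continuous_intros; simp add: nz)
qed

lemma continuous_on_mat2_mult:
  fixes F G :: "real \<Rightarrow> real^2^2"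
  assumes "continuous_on S F" "continuous_on S G"
  shows "continuous_on S (\<lambda>t. F t ** G t)"
  by (rule continuous_on_mat2I; unfold mat2_mult_entry; intro continuous_intros assms)

lemma letter_first_order:
  "\<exists>F. continuous_on {0..} F \<and> (\<forall>t\<ge>0. eval_letter (famA t) (famB t) l = mat 1 + t *\<^sub>R F t) \<and>
       F 0 = expsum GX [l] *\<^sub>R famU 0 + expsum GY [l] *\<^sub>R famV 0"
proof -
  have cont_adj: "continuous_on {0..} (\<lambda>t. adj2 (F t))" if "continuous_on {0..} F"
    for F :: "real \<Rightarrow> real^2^2"
    by (rule continuous_on_mat2I; unfold adj2_entries; intro continuous_intros that)
  have adj: "adj2 (mat 1 + t *\<^sub>R M) = mat 1 + t *\<^sub>R adj2 M" for t and M :: "real^2^2"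
    by (simp add: mat2_eq_iff mat_1_2_entries)
  define F where "F = (case fst l of GX \<Rightarrow> famU | GY \<Rightarrow> famV)"
  have F: "continuous_on {0..} F"
    by (auto simp: F_def famU_famV_continuous split: gen.split)
  show ?thesis
  proof (rule exI[of _ "\<lambda>t. if snd l then F t else adj2 (F t)"], intro conjI allI impI)
    show "continuous_on {0..} (\<lambda>t. if snd l then F t else adj2 (F t))"
      using F cont_adj[OF F] by (cases "snd l") simp_all
  qed (cases "fst l"; auto simp: F_def eval_letter_def famA_def famB_def adj expsum_Cons mat2_eq_iff mat_1_2_entries)+
qed

text \<open>At \<open>t = 0\<close> the product rule turns products of words into sums of derivatives, so that
  only the exponent sums matter.\<close>

lemma word_first_order:
  "\<exists>F. continuous_on {0..} F \<and> (\<forall>t\<ge>0. eval_word (famA t) (famB t) w = mat 1 + t *\<^sub>R F t) \<and>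
       F 0 = expsum GX w *\<^sub>R famU 0 + expsum GY w *\<^sub>R famV 0"
proof (induction w)
  case Nil
  show ?case by (rule exI[of _ "\<lambda>_. 0"]) simp
next
  case (Cons l w)
  obtain F where F: "continuous_on {0..} F"
    "\<And>t. t \<ge> 0 \<Longrightarrow> eval_word (famA t) (famB t) w = mat 1 + t *\<^sub>R F t"
    "F 0 = expsum GX w *\<^sub>R famU 0 + expsum GY w *\<^sub>R famV 0"
    using Cons.IH by auto
  obtain L where L: "continuous_on {0..} L"
    "\<And>t. t \<ge> 0 \<Longrightarrow> eval_letter (famA t) (famB t) l = mat 1 + t *\<^sub>R L t"
    "L 0 = expsum GX [l] *\<^sub>R famU 0 + expsum GY [l] *\<^sub>R famV 0"
    using letter_first_order by blast
  have mult: "(mat 1 + t *\<^sub>R M) ** (mat 1 + t *\<^sub>R N) = mat 1 + t *\<^sub>R (M + N + t *\<^sub>R (M ** N))"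
    for t and M N :: "real^2^2"
    by (simp add: mat2_eq_iff mat2_simps algebra_simps)
  show ?case
  proof (rule exI[of _ "\<lambda>t. L t + F t + t *\<^sub>R (L t ** F t)"], intro conjI allI impI)
    show "continuous_on {0..} (\<lambda>t. L t + F t + t *\<^sub>R (L t ** F t))"
      by (intro continuous_intros continuous_on_mat2_mult F L)
    show "L 0 + F 0 + 0 *\<^sub>R (L 0 ** F 0) =
        expsum GX (l # w) *\<^sub>R famU 0 + expsum GY (l # w) *\<^sub>R famV 0"
      by (simp add: L F expsum_Cons[of _ l w] expsum_Cons[of _ l "[]"] algebra_simps)
  qed (simp add: F L mult)
qed

lemma family_bracket_generators:
  assumes "t > 0"
  shows "det (famA t ** famB t - famB t ** famA t) > 0"
proof -
  have "t + t / (1 + t) > 0"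
    using assms by (simp add: add_pos_pos)
  then have a: "famA t $1$1 - famA t $2$2 > 0"
    by (simp add: famA_def mat_1_2_entries)
  have b: "famB t $1$2 > 0" "famB t $2$1 > 0"
    using assms by (simp_all add: famB_def mat_1_2_entries add_pos_pos)
  have "det (famA t ** famB t - famB t ** famA t) =
          (famA t $1$1 - famA t $2$2)\<^sup>2 * (famB t $1$2 * famB t $2$1)"
    by (simp add: famA_def mat2_simps algebra_simps power2_eq_square)
  then show ?thesis
    using a b by simp
qed

text \<open>The sign of the bracket is the same for every generating pair as for the free generators:
  it is positive for small \<open>t\<close> and cannot change.\<close>

lemma family_bracket_pos:
  assumes gh: "g \<in> carrier F2" "h \<in> carrier F2" "generate F2 {g, h} = carrier F2" and "t > 0"
  defines "\<rho> \<equiv> \<lambda>t. eval_word (famA t) (famB t)"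
  shows "det (\<rho> t g ** \<rho> t h - \<rho> t h ** \<rho> t g) > 0"
proof -
  obtain G where G: "continuous_on {0..} G" "\<And>t. t \<ge> 0 \<Longrightarrow> \<rho> t g = mat 1 + t *\<^sub>R G t"
    "G 0 = expsum GX g *\<^sub>R famU 0 + expsum GY g *\<^sub>R famV 0"
    using word_first_order[of g] unfolding \<rho>_def by auto
  obtain H where H: "continuous_on {0..} H" "\<And>t. t \<ge> 0 \<Longrightarrow> \<rho> t h = mat 1 + t *\<^sub>R H t"
    "H 0 = expsum GX h *\<^sub>R famU 0 + expsum GY h *\<^sub>R famV 0"
    using word_first_order[of h] unfolding \<rho>_def by auto
  define D where "D t = det (G t ** H t - H t ** G t)" for t
  have D: "det (\<rho> t g ** \<rho> t h - \<rho> t h ** \<rho> t g) = t^4 * D t" if "t \<ge> 0" for t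
    unfolding G(2)[OF that] H(2)[OF that] D_def
    by (simp add: mat2_simps algebra_simps power4_eq_xxxx)
  have cont: "continuous_on {0..} D"
    unfolding D_def det_2
    by (intro continuous_intros continuous_on_mat2_mult G H)
  \<comment> \<open>The bracket is bilinear and alternating, so \<open>D 0\<close> is \<open>det (U V - V U) = 3\<close>, for
    \<open>U = famU 0\<close> and \<open>V = famV 0\<close>, times the square of the determinant of the exponent sums.\<close>
  have "D 0 = 3 * (expsum GX g * expsum GY h - expsum GY g * expsum GX h)\<^sup>2"
    unfolding D_def G H by (simp add: mat2_simps field_simps power2_eq_square)
  then have D0: "D 0 > 0"
    using expsum_det_nonzero[OF gh] by simp
  have nz: "D s \<noteq> 0" if "s > 0" for s
  proof
    assume "D s = 0"
    then have "det (\<rho> s g ** \<rho> s h - \<rho> s h ** \<rho> s g) = 0"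
      using D[of s] that by simp
    then have "det (\<rho> s gX ** \<rho> s gY - \<rho> s gY ** \<rho> s gX) = 0"
      using that famA_props[of s] famB_props[of s]
      by (intro det_bracket_eq_0_of_generators[OF _ _ _ gh _ gX_in_F2 gY_in_F2])
         (auto simp: \<rho>_def eval_word_mult det_eval_word, simp add: F2_def)
    then show False
      using family_bracket_generators[OF that] by (simp add: \<rho>_def eval_word_gX eval_word_gY)
  qed
  have "D t > 0"
  proof (rule ccontr)
    assume "\<not> D t > 0"
    moreover have "continuous_on {0..t} D"
      using cont by (rule continuous_on_subset) auto
    ultimately obtain s where "0 \<le> s" "s \<le> t" "D s = 0"
      using IVT2'[of D t 0 0] D0 \<open>t > 0\<close> by auto
    then show False using nz[of s] D0 by (cases "s = 0") auto
  qed
  then show ?thesis using D[of t] \<open>t > 0\<close> by simp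
qed

section \<open>Membership in the Bowditch set\<close>

text \<open>A real matrix as a complex one.\<close>

definition cmat :: "real^2^2 \<Rightarrow> complex^2^2" where
  "cmat M = (\<chi> i j. complex_of_real (M$i$j))"

lemma cmat_simps [simp]:
  "cmat M $ i $ j = complex_of_real (M$i$j)"
  "cmat (mat 1) = mat 1" "cmat (M ** N) = cmat M ** cmat N"
  "cmat (M - N) = cmat M - cmat N"
  "det (cmat M) = complex_of_real (det M)" "trace (cmat M) = complex_of_real (trace M)"
  by (simp_all add: cmat_def mat2_eq_iff mat2_simps)

lemma in_Bowditch_set:
  fixes x :: real
  assumes "x > 2"
  shows "(complex_of_real x, complex_of_real x, complex_of_real x) \<in> Bowditch_set"
proof -
  \<comment> \<open>\<open>1 + t\<close> is the larger root of \<open>m^2 - x m + 1\<close>.\<close>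
  define s where "s = sqrt (x\<^sup>2 - 4)"
  define t where "t = (x + s) / 2 - 1"
  have sq: "x\<^sup>2 - 4 \<ge> 0"
    using power_mono[of 2 x 2] assms by simp
  then have "s \<ge> 0" by (simp add: s_def)
  then have t: "t > 0"
    using assms by (simp add: t_def)
  have "(1 + t) * (x - (1 + t)) = (x\<^sup>2 - s\<^sup>2) / 4"
    unfolding t_def by (simp add: field_simps power2_eq_square)
  also have "\<dots> = 1" using sq by (simp add: s_def)
  finally have "x - (1 + t) = 1 / (1 + t)"
    using t by (simp add: field_simps)
  then have tx: "1 + t + 1 / (1 + t) = x" by simp
  define R where "R = eval_word (famA t) (famB t)"
  define \<rho> where "\<rho> w = cmat (R w)" for w
  have dets: "det (famA t) = 1" "det (famB t) = 1"
    using famA_props famB_props t by auto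
  have mult: "\<rho> (u \<otimes>\<^bsub>F2\<^esub> v) = \<rho> u ** \<rho> v" for u v
    by (simp add: \<rho>_def R_def eval_word_mult[OF dets])
  have rep: "rep_with_traces x x x \<rho>"
    unfolding rep_with_traces_def mult
    using famA_props(2)[of t] famB_props(2,3)[of t] t tx
    by (auto simp: hom_def SL2C_def mult)
       (simp_all add: \<rho>_def R_def eval_word_gX eval_word_gY det_eval_word[OF dets] flip: cmat_simps(3))
  have irr: "irreducible_rep \<rho>"
    unfolding irreducible_rep_def
  proof
    assume "\<exists>v. v \<noteq> 0 \<and> (\<forall>g\<in>carrier F2. \<exists>c. \<rho> g *v v = c *s v)"
    then obtain v where v: "v \<noteq> 0" "\<And>g. g \<in> carrier F2 \<Longrightarrow> \<exists>c. \<rho> g *v v = c *s v"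
      by blast
    obtain c d where "\<rho> gX *v v = c *s v" "\<rho> gY *v v = d *s v"
      using v(2)[OF gX_in_F2] v(2)[OF gY_in_F2] by blast
    then have "det (\<rho> gX ** \<rho> gY - \<rho> gY ** \<rho> gX) = 0"
      by (rule det_bracket_eq_0_if_common_eigenvector[OF v(1)])
    then have "det (famA t ** famB t - famB t ** famA t) = 0"
      by (simp add: \<rho>_def R_def eval_word_gX eval_word_gY flip: cmat_simps(3,4))
    then show False
      using family_bracket_generators[OF t] by simp
  qed
  have big: "\<bar>trace (R g)\<bar> > 2" if "primitive g" for g
  proof -
    obtain h where "g \<in> carrier F2" "h \<in> carrier F2" "generate F2 {g, h} = carrier F2"
      using \<open>primitive g\<close> unfolding primitive_def by blast
    then have "det (R g ** R h - R h ** R g) > 0"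
      unfolding R_def using t by (rule family_bracket_pos)
    then show ?thesis
      by (intro trace_gt_2_if_det_bracket_pos[of _ "R h"]) (simp_all add: R_def det_eval_word[OF dets])
  qed
  have "trace (\<rho> g) \<notin> complex_of_real ` {-2..2}" if "primitive g" for g
    using big[OF that] by (auto simp: \<rho>_def)
  moreover have none: "{g. primitive g \<and> cmod (trace (\<rho> g)) \<le> 2} = {}"
    using big by (force simp: \<rho>_def)
  ultimately show ?thesis
    using rep irr unfolding Bowditch_set_def mem_Collect_eq prod.case
    by (intro exI[of _ \<rho>]) (unfold none, simp)
qed

section \<open>Exclusion from Schottky space\<close>

lemma loxodromic_trace:
  assumes "loxodromic A"
  obtains l where "cmod l > 1" "trace A = l + inverse l"
proof -
  obtain P l where P: "det P = 1" and l: "cmod l > 1" and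
    A: "A = P ** vector [vector [l, 0], vector [0, inverse l]] ** matrix_inv P"
    using assms unfolding loxodromic_def SL2C_def by auto
  let ?D = "vector [vector [l, 0], vector [0, inverse l]] :: complex^2^2"
  have "invertible P" using P by (simp add: invertible_det_nz)
  then have inv: "matrix_inv P ** P = mat 1"
    unfolding matrix_inv_def invertible_def by (rule someI2_ex) simp
  have "trace A = trace (matrix_inv P ** (P ** ?D))"
    unfolding A by (rule trace_mul_sym)
  also have "\<dots> = trace ?D"
    by (simp add: matrix_mul_assoc inv)
  also have "\<dots> = l + inverse l"
    by (simp add: trace_2)
  finally show thesis using l that by blast
qed

lemma not_loxodromic:
  assumes "trace A = complex_of_real r" "\<bar>r\<bar> < 2"
  shows "\<not> loxodromic A"
proof
  assume "loxodromic A"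
  then obtain l where l: "cmod l > 1" and tr: "complex_of_real r = l + inverse l"
    using loxodromic_trace assms(1) by metis
  have l0: "l \<noteq> 0" using l by auto
  have cm: "(Re l)\<^sup>2 + (Im l)\<^sup>2 > 1"
    using l by (simp add: cmod_def)
  have "0 = Im (l + inverse l)"
    by (simp flip: tr)
  then have "Im l * (1 - 1 / ((Re l)\<^sup>2 + (Im l)\<^sup>2)) = 0"
    by (simp add: algebra_simps)
  then have im: "Im l = 0"
    using cm by auto
  then have l_real: "l = complex_of_real (Re l)"
    by (simp add: complex_eq_iff)
  have "complex_of_real r = complex_of_real (Re l + inverse (Re l))"
    using tr by (subst (asm) (1 2) l_real) simp
  then have re: "r = Re l + 1 / Re l" "Re l \<noteq> 0"
    using l_real l0 by (auto simp only: of_real_eq_iff divide_inverse mult_1_left of_real_0)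
  have "r\<^sup>2 = (Re l - 1 / Re l)\<^sup>2 + 4"
    using re by (simp add: power2_eq_square algebra_simps)
  then have "r\<^sup>2 \<ge> 2\<^sup>2" by simp
  then show False
    using assms(2) abs_le_square_iff[of 2 r] by simp
qed

lemma not_in_Schottky_space:
  fixes x :: real
  assumes "2 < x" "x < 3"
  shows "(complex_of_real x, complex_of_real x, complex_of_real x) \<notin> Schottky_space"
proof
  interpret F2: group F2 by (rule group_F2)
  let ?x = "complex_of_real x"
  assume "(?x, ?x, ?x) \<in> Schottky_space"
  then obtain \<rho> where rep: "rep_with_traces ?x ?x ?x \<rho>"
    and lox: "purely_loxodromic (\<rho> ` carrier F2)"
    unfolding Schottky_space_def by blast
  note XY = gX_in_F2 gY_in_F2
  have hom: "\<rho> \<in> hom F2 SL2C" using rep by (simp add: rep_with_traces_def)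
  then interpret group_hom F2 SL2C \<rho>
    by (simp add: group_hom_def group_hom_axioms_def group_F2 group_SL2C)
  have det1: "det (\<rho> u) = 1" if "u \<in> carrier F2" for u
    using hom_closed[OF that] by (simp add: SL2C_def)
  have mult: "\<rho> (u \<otimes>\<^bsub>F2\<^esub> v) = \<rho> u ** \<rho> v" if "u \<in> carrier F2" "v \<in> carrier F2" for u v
    using hom_mult[OF that] by (simp add: SL2C_def)
  have inv: "\<rho> (inv\<^bsub>F2\<^esub> u) = adj2 (\<rho> u)" if "u \<in> carrier F2" for u
  proof (rule left_inverse_eq_adj2[OF det1[OF that]])
    have "\<rho> (inv\<^bsub>F2\<^esub> u \<otimes>\<^bsub>F2\<^esub> u) = mat 1"
      unfolding F2.l_inv[OF that] hom_one by (simp add: SL2C_def)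
    then show "\<rho> (inv\<^bsub>F2\<^esub> u) ** \<rho> u = mat 1"
      using that by (simp only: mult F2.inv_closed)
  qed
  define w where "w = gX \<otimes>\<^bsub>F2\<^esub> gY \<otimes>\<^bsub>F2\<^esub> inv\<^bsub>F2\<^esub> gX \<otimes>\<^bsub>F2\<^esub> inv\<^bsub>F2\<^esub> gY"
  define r where "r = 3 * x\<^sup>2 - x ^ 3 - 2"
  have w: "w \<in> carrier F2" using XY by (simp add: w_def)
  have "\<rho> w = \<rho> gX ** \<rho> gY ** adj2 (\<rho> gX) ** adj2 (\<rho> gY)"
    using XY by (simp only: w_def mult inv F2.m_closed F2.inv_closed)
  then have "trace (\<rho> w) = ?x^2 + ?x^2 + ?x^2 - ?x * ?x * ?x - 2"
    using rep trace_commutator[OF det1[OF XY(1)] det1[OF XY(2)]] mult[OF XY]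
    by (simp add: rep_with_traces_def)
  then have tr: "trace (\<rho> w) = complex_of_real r"
    by (simp add: r_def power3_eq_cube)
  have "2 - r = (x - 2)\<^sup>2 * (x + 1)" "2 + r = x\<^sup>2 * (3 - x)"
    unfolding r_def by algebra+
  moreover have "(x - 2)\<^sup>2 * (x + 1) > 0" "x\<^sup>2 * (3 - x) > 0"
    using assms by simp_all
  ultimately have r: "\<bar>r\<bar> < 2" by linarith
  have "\<rho> w \<noteq> mat 1"
  proof
    assume "\<rho> w = mat 1"
    then have "complex_of_real r = complex_of_real 2"
      using tr by (simp add: mat2_simps)
    then show False using r unfolding of_real_eq_iff by simp
  qed
  then have "loxodromic (\<rho> w)"
    using lox w by (auto simp: purely_loxodromic_def)
  then show False
    using not_loxodromic[OF tr r] by blast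
qed

theorem mainTheorem1:
  fixes x :: real
  assumes "2 < x" and "x < 3"
  shows "(complex_of_real x, complex_of_real x, complex_of_real x) \<in> Bowditch_set - Schottky_space"
  using in_Bowditch_set[OF assms(1)] not_in_Schottky_space[OF assms] by blast

end
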